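(* Let $\alpha\in\mathbb{R}^d$, let $X$ be a random vector in $\mathbb{R}^d$ with probability density function $$p_\alpha(x)=2\,\omega_d(x;I_d)\,\Phi(\alpha^Tx),\qquad x\in\mathbb{R}^d,$$ and let $Z$ be a $d$-dimensional standard normal random vector. Then $$d_{\mathcal{W}}(X,Z)=\sqrt{\frac2\pi}\;\frac{\|\alpha\|}{\sqrt{1+\|\alpha\|^2}}.$$
   Context: $\omega_d(x;I_d)=(2\pi)^{-d/2}e^{-\|x\|^2/2}$ is the density of $\mathcal{N}(0,I_d)$ on $\mathbb{R}^d$, $\Phi$ is the cumulative distribution function of the standard normal law on $\mathbb{R}$, and $\|\cdot\|$ is the Euclidean norm. The 1-Wasserstein distance is $d_{\mathcal{W}}(X,Z)=\sup_h|\mathbb{E}[h(X)]-\mathbb{E}[h(Z)]|$ over all $h:\mathbb{R}^d\to\mathbb{R}$ with Lipschitz constant at most $1$. *)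

theory Defs
  imports "HOL-Probability.Probability"
begin

definition std_normal_vec_density :: "real ^ 'n \<Rightarrow> real" where
  "std_normal_vec_density x = (2 * pi) powr (- (real CARD('n) / 2)) * exp (- (norm x)\<^sup>2 / 2)"

definition std_normal_cdf :: "real \<Rightarrow> real" where
  "std_normal_cdf = cdf std_normal_distribution"

definition skew_normal_density :: "real ^ 'n \<Rightarrow> real ^ 'n \<Rightarrow> real" where
  "skew_normal_density \<alpha> x = 2 * std_normal_vec_density x * std_normal_cdf (\<alpha> \<bullet> x)"

(* The two random vectors may live on different probability spaces, since only their laws
   matter. The supremum is taken in ereal, so an unbounded set of differences gives infinity.
   The formula has its usual meaning only for random vectors with a finite first moment, for
   which h(X) is integrable for every Lipschitz h: the Bochner integral of a non-integrable
   function is 0. *)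
definition wasserstein1 ::
  "'a measure \<Rightarrow> ('a \<Rightarrow> real ^ 'n) \<Rightarrow> 'b measure \<Rightarrow> ('b \<Rightarrow> real ^ 'n) \<Rightarrow> ereal" where
  "wasserstein1 M X N Z =
     (SUP h \<in> {h :: real ^ 'n \<Rightarrow> real. 1-lipschitz_on UNIV h}.
        ereal \<bar>(\<integral>\<omega>. h (X \<omega>) \<partial>M) - (\<integral>\<omega>. h (Z \<omega>) \<partial>N)\<bar>)"

end

theory Submission
  imports Defs
begin

text \<open>
  Put \<open>\<beta> = \<alpha> / (1 + \<parallel>\<alpha>\<parallel>\<^sup>2)\<close> and let \<open>T\<close> be a centred normal variable of variance
  \<open>1 + \<parallel>\<alpha>\<parallel>\<^sup>2\<close>. Completing the square in \<open>\<omega>\<^sub>d(x) \<phi>(t - \<alpha>\<^sup>T x)\<close> after the translation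
  \<open>x = t \<beta> + z\<close> splits this product into the density of \<open>T\<close> at \<open>t\<close> times a density in \<open>z\<close>
  alone. Hence, for \<open>W\<close> independent of \<open>T\<close> with the latter density, \<open>Z\<close> has the law of
  \<open>T \<beta> + W\<close>; since \<open>\<Phi>(\<alpha>\<^sup>T x)\<close> is the integral of \<open>\<phi>(t - \<alpha>\<^sup>T x)\<close> over \<open>t \<ge> 0\<close>, \<open>X\<close> has the
  law of \<open>\<bar>T\<bar> \<beta> + W\<close>. The cost of this coupling is
  \<open>\<parallel>\<beta>\<parallel> E(\<bar>T\<bar> - T) = \<parallel>\<beta>\<parallel> E\<bar>T\<bar>\<close>, and the linear function in the direction of \<open>\<beta>\<close> attains it.
\<close>

section \<open>Gaussian integrals in several variables\<close>

lemma exp_norm_sq_eq_prod: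
  fixes x :: "'a::euclidean_space"
  shows "exp (c * (norm x)\<^sup>2) = (\<Prod>b\<in>Basis. exp (c * (x \<bullet> b)\<^sup>2))"
proof -
  have "(norm x)\<^sup>2 = (\<Sum>b\<in>Basis. (x \<bullet> b)\<^sup>2)"
    unfolding power2_norm_eq_inner by (subst euclidean_inner) (simp add: power2_eq_square)
  then show ?thesis
    by (simp add: sum_distrib_left exp_sum)
qed

text \<open>The integrand is a product over the coordinates, so its integral is a finite power of a
  one-dimensional Gaussian integral. It later dominates the first moment of the standard normal
  density.\<close>

lemma integrable_exp_neg_norm_sq:
  assumes "0 < c"
  shows "integrable lborel (\<lambda>x::'a::euclidean_space. exp (- c * (norm x)\<^sup>2))"
proof (rule integrableI_bounded)
  \<comment> \<open>The factor \<open>sqrt (pi / c)\<close> cancels the normalization of the normal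
    density of variance \<open>1 / (2 * c)\<close>.\<close>
  have "integrable lborel (\<lambda>t::real. sqrt (pi / c) * normal_density 0 (sqrt (1 / (2 * c))) t)"
    using assms by (intro integrable_mult_right integrable_normal_density) simp
  also have "(\<lambda>t::real. sqrt (pi / c) * normal_density 0 (sqrt (1 / (2 * c))) t) = (\<lambda>t. exp (- c * t\<^sup>2))"
    using assms by (simp add: fun_eq_iff normal_density_def real_sqrt_divide field_simps)
  finally have fin: "(\<integral>\<^sup>+t. ennreal (exp (- c * t\<^sup>2)) \<partial>lborel) < \<infinity>"
    by (simp add: integrable_iff_bounded)
  have "(\<integral>\<^sup>+x. ennreal (norm (exp (- c * (norm (x::'a))\<^sup>2))) \<partial>lborel)
      = (\<integral>\<^sup>+x. (\<Prod>b\<in>Basis. ennreal (exp (- c * ((x::'a) \<bullet> b)\<^sup>2))) \<partial>lborel)"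
    by (simp only: exp_norm_sq_eq_prod) (simp add: prod_ennreal abs_of_nonneg prod_nonneg)
  also have "\<dots> = (\<Prod>b\<in>(Basis::'a set). \<integral>\<^sup>+t. ennreal (exp (- c * t\<^sup>2)) \<partial>lborel)"
    by (rule nn_integral_lborel_prod) auto
  also have "\<dots> < \<infinity>"
    using fin by (simp add: power_less_top_ennreal)
  finally show "(\<integral>\<^sup>+x. ennreal (norm (exp (- c * (norm (x::'a))\<^sup>2))) \<partial>lborel) < \<infinity>" .
qed measurable

lemma std_normal_vec_density_nonneg [simp]: "0 \<le> std_normal_vec_density x"
  by (simp add: std_normal_vec_density_def)

lemma borel_measurable_std_normal_vec_density [measurable]:
  "std_normal_vec_density \<in> borel_measurable borel"
  unfolding std_normal_vec_density_def by measurable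

lemma std_normal_vec_density_eq_prod:
  "std_normal_vec_density (x :: real ^ 'n) = (\<Prod>b\<in>Basis. std_normal_density (x \<bullet> b))"
proof -
  have "(2 * pi) powr (- (real CARD('n) / 2)) = ((2 * pi) powr (- (1 / 2))) ^ CARD('n)"
    by (simp add: powr_powr flip: powr_realpow)
  also have "(2 * pi) powr (- (1 / 2)) = 1 / sqrt (2 * pi)"
    by (simp add: powr_minus_divide powr_half_sqrt)
  finally have "(2 * pi) powr (- (real CARD('n) / 2)) = (\<Prod>b\<in>(Basis::(real ^ 'n) set). 1 / sqrt (2 * pi))"
    by simp
  moreover have "exp (- (norm x)\<^sup>2 / 2) = (\<Prod>b\<in>Basis. exp (- (x \<bullet> b)\<^sup>2 / 2))"
    using exp_norm_sq_eq_prod[of "- (1 / 2)" x] by simp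
  ultimately show ?thesis
    unfolding std_normal_vec_density_def std_normal_density_def prod.distrib by simp
qed

lemma nn_integral_std_normal_vec_density:
  "(\<integral>\<^sup>+x. ennreal (std_normal_vec_density (x :: real ^ 'n)) \<partial>lborel) = 1"
proof -
  have "(\<integral>\<^sup>+x. ennreal (std_normal_vec_density (x :: real ^ 'n)) \<partial>lborel)
      = (\<integral>\<^sup>+x. (\<Prod>b\<in>Basis. ennreal (std_normal_density ((x :: real ^ 'n) \<bullet> b))) \<partial>lborel)"
    by (simp add: std_normal_vec_density_eq_prod prod_ennreal)
  also have "\<dots> = (\<Prod>b\<in>(Basis::(real ^ 'n) set). \<integral>\<^sup>+t. ennreal (std_normal_density t) \<partial>lborel)"
    by (rule nn_integral_lborel_prod) auto
  also have "(\<integral>\<^sup>+t. ennreal (std_normal_density t) \<partial>lborel) = 1"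
    by (simp add: nn_integral_eq_integral)
  finally show ?thesis by simp
qed

text \<open>Half of the exponent absorbs the linear factor: r is at most exp (r^2 / 4) for r =
  \<open>norm x\<close>, which leaves the integrable exp (- r^2 / 4).\<close>

lemma integrable_norm_std_normal_vec_density:
  "integrable lborel (\<lambda>x :: real ^ 'n. std_normal_vec_density x * norm x)"
proof (rule Bochner_Integration.integrable_bound)
  show "integrable lborel (\<lambda>x :: real ^ 'n. (2 * pi) powr (- (real CARD('n) / 2)) * exp (- (1 / 4) * (norm x)\<^sup>2))"
    by (intro integrable_mult_right integrable_exp_neg_norm_sq) simp
  have "exp (- (norm x)\<^sup>2 / 2) * norm x \<le> exp (- (1 / 4) * (norm x)\<^sup>2)" for x :: "real ^ 'n"
  proof -
    \<comment> \<open>Expanding this square gives exactly r \<le> 1 + r^2 / 4 for r =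
      \<open>norm x\<close>.\<close>
    have "0 \<le> (norm x / 2 - 1)\<^sup>2" by simp
    then have "norm x \<le> 1 + (norm x)\<^sup>2 / 4"
      by (simp add: power2_eq_square field_simps)
    also have "\<dots> \<le> exp ((norm x)\<^sup>2 / 4)" by (rule exp_ge_add_one_self)
    finally have "exp (- (norm x)\<^sup>2 / 2) * norm x \<le> exp (- (norm x)\<^sup>2 / 2) * exp ((norm x)\<^sup>2 / 4)"
      by simp
    also have "\<dots> = exp (- (1 / 4) * (norm x)\<^sup>2)"
      by (simp add: field_simps flip: exp_add)
    finally show ?thesis .
  qed
  then show "AE x in lborel. norm (std_normal_vec_density x * norm x)
      \<le> norm ((2 * pi) powr (- (real CARD('n) / 2)) * exp (- (1 / 4) * (norm (x :: real ^ 'n))\<^sup>2))"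
    by (simp add: std_normal_vec_density_def mult.assoc)
qed measurable

section \<open>The normal cdf as a half-line integral, and symmetries of Lebesgue measure\<close>

text \<open>The substitution u = a - t and the evenness of the density turn the range u \<le> a into
  t \<ge> 0. For a = \<open>\<alpha> \<bullet> x\<close> this exposes the hidden variable t on which
  the coupling is built.\<close>

lemma std_normal_cdf_eq_nn_integral:
  "ennreal (std_normal_cdf a) = (\<integral>\<^sup>+t. indicator {0..} t * ennreal (std_normal_density (t - a)) \<partial>lborel)"
proof -
  interpret real_distribution std_normal_distribution by (rule real_dist_normal_dist)
  have "ennreal (std_normal_cdf a) = emeasure std_normal_distribution {..a}"
    by (simp add: std_normal_cdf_def cdf_def emeasure_eq_measure)
  also have "\<dots> = (\<integral>\<^sup>+u. ennreal (std_normal_density u) * indicator {..a} u \<partial>lborel)"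
    by (simp add: emeasure_density)
  also have "\<dots> = (\<integral>\<^sup>+t. ennreal (std_normal_density (a + - 1 * t)) * indicator {..a} (a + - 1 * t) \<partial>lborel)"
    by (subst nn_integral_real_affine[where c = "- 1" and t = a]) auto
  also have "\<dots> = (\<integral>\<^sup>+t. indicator {0..} t * ennreal (std_normal_density (t - a)) \<partial>lborel)"
    by (intro nn_integral_cong) (auto simp: std_normal_density_def indicator_def power2_commute)
  finally show ?thesis .
qed

lemma std_normal_cdf_nonneg [simp]: "0 \<le> std_normal_cdf a"
  by (simp add: std_normal_cdf_def cdf_def)

text \<open>This folding accounts for the factor 2 in the skew normal density: the half-line with
  double weight becomes the whole line with t replaced by its absolute value.\<close>

lemma nn_integral_abs_eq:
  fixes f :: "real \<Rightarrow> ennreal"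
  assumes [measurable]: "f \<in> borel_measurable borel"
  shows "(\<integral>\<^sup>+t. f \<bar>t\<bar> \<partial>lborel) = (\<integral>\<^sup>+t. 2 * indicator {0..} t * f t \<partial>lborel)"
proof -
  have "(\<integral>\<^sup>+t. f \<bar>t\<bar> \<partial>lborel) = (\<integral>\<^sup>+t. indicator {0..} t * f t + indicator {..<0} t * f (- t) \<partial>lborel)"
    by (intro nn_integral_cong) (auto simp: indicator_def)
  also have "\<dots> = (\<integral>\<^sup>+t. indicator {0..} t * f t \<partial>lborel) + (\<integral>\<^sup>+t. indicator {..<0} t * f (- t) \<partial>lborel)"
    by (rule nn_integral_add) auto
  also have "(\<integral>\<^sup>+t. indicator {..<0} t * f (- t) \<partial>lborel) = (\<integral>\<^sup>+t. indicator {..<0} (- t) * f t \<partial>lborel)"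
    by (subst nn_integral_real_affine[where c = "- 1" and t = 0]) auto
  \<comment> \<open>\<open>indicator {..<0} (- t)\<close> is the indicator of t > 0, so the two
    integrands can differ only at t = 0, a null set.\<close>
  also have "\<dots> = (\<integral>\<^sup>+t. indicator {0..} t * f t \<partial>lborel)"
    using AE_lborel_singleton[of "0::real"]
    by (intro nn_integral_cong_AE) (auto simp: indicator_def elim!: eventually_mono)
  also have "(\<integral>\<^sup>+t. indicator {0..} t * f t \<partial>lborel) + (\<integral>\<^sup>+t. indicator {0..} t * f t \<partial>lborel)
      = (\<integral>\<^sup>+t. 2 * indicator {0..} t * f t \<partial>lborel)"
    by (simp add: nn_integral_cmult mult.assoc flip: mult_2)
  finally show ?thesis .
qed

lemma nn_integral_lborel_translate:
  fixes f :: "'a::euclidean_space \<Rightarrow> ennreal"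
  assumes [measurable]: "f \<in> borel_measurable borel"
  shows "(\<integral>\<^sup>+x. f x \<partial>lborel) = (\<integral>\<^sup>+x. f (c + x) \<partial>lborel)"
  by (subst lborel_distr_plus[symmetric, of c]) (simp add: nn_integral_distr)

section \<open>Splitting the joint density of T and Z\<close>

text \<open>If T is \<open>\<alpha> \<bullet> Z\<close> plus an independent standard normal
  variable, then T has covariance \<alpha> with Z and variance
  \<open>1 + (norm \<alpha>)\<^sup>2\<close>. The quotient is the regression coefficient \<beta>
  that makes Z - T \<beta> uncorrelated with T.\<close>

definition skew_direction :: "real ^ 'n \<Rightarrow> real ^ 'n" where
  "skew_direction \<alpha> = \<alpha> /\<^sub>R (1 + (norm \<alpha>)\<^sup>2)"

text \<open>The density of \<open>Z - T \<beta>\<close>; the square root is the normalization of the density of \<open>T\<close>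
  moved to this factor.\<close>

definition residual_density :: "real ^ 'n \<Rightarrow> real ^ 'n \<Rightarrow> real" where
  "residual_density \<alpha> z = sqrt (1 + (norm \<alpha>)\<^sup>2) * std_normal_vec_density z * exp (- (\<alpha> \<bullet> z)\<^sup>2 / 2)"

abbreviation (input) skew_scale :: "real ^ 'n \<Rightarrow> real" where
  "skew_scale \<alpha> \<equiv> sqrt (1 + (norm \<alpha>)\<^sup>2)"

lemma one_plus_norm_sq_pos: "0 < 1 + (norm \<alpha>)\<^sup>2"
  by (simp add: add_pos_nonneg)

lemma skew_scale_pos: "0 < skew_scale \<alpha>"
  using one_plus_norm_sq_pos[of \<alpha>] by simp

lemma norm_skew_direction: "norm (skew_direction \<alpha>) = norm \<alpha> / (1 + (norm \<alpha>)\<^sup>2)"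
  using one_plus_norm_sq_pos[of \<alpha>] by (simp add: skew_direction_def divide_inverse)

lemma residual_density_nonneg [simp]: "0 \<le> residual_density \<alpha> z"
  by (simp add: residual_density_def)

lemma borel_measurable_residual_density [measurable]:
  "residual_density \<alpha> \<in> borel_measurable borel"
  unfolding residual_density_def by measurable

text \<open>The left side is the joint density of Z and T. With s =
  \<open>(norm \<alpha>)\<^sup>2\<close>, the two squares in its exponent add up to t^2 / (1 + s)
  plus a function of z alone, with no mixed term.\<close>

lemma skew_density_factorization:
  fixes \<alpha> z :: "real ^ 'n" and t :: real
  defines "x \<equiv> t *\<^sub>R skew_direction \<alpha> + z"
  shows "std_normal_vec_density x * std_normal_density (t - \<alpha> \<bullet> x)
       = normal_density 0 (skew_scale \<alpha>) t * residual_density \<alpha> z"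
proof -
  define s where "s = (norm \<alpha>)\<^sup>2"
  define p where "p = \<alpha> \<bullet> z"
  have s: "0 < 1 + s" unfolding s_def by (rule one_plus_norm_sq_pos)
  have dir: "skew_direction \<alpha> = (1 / (1 + s)) *\<^sub>R \<alpha>"
    by (simp add: skew_direction_def s_def divide_inverse)
  have aa: "\<alpha> \<bullet> \<alpha> = s" by (simp add: s_def power2_norm_eq_inner)
  have za: "z \<bullet> \<alpha> = p" by (simp add: p_def inner_commute)
  have ax: "\<alpha> \<bullet> x = t * s / (1 + s) + p"
    by (simp add: x_def dir inner_add_right aa p_def)
  have xx: "(norm x)\<^sup>2 = t\<^sup>2 * s / (1 + s)\<^sup>2 + 2 * t * p / (1 + s) + (norm z)\<^sup>2"
    unfolding power2_norm_eq_inner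
    by (simp add: x_def dir inner_add_left inner_add_right aa za p_def[symmetric] power2_eq_square)
       (simp add: add_divide_distrib distrib_left mult.assoc)
  have "t - (t * s / (1 + s) + p) = t / (1 + s) - p"
    using s by (simp add: field_simps)
  then have "(norm x)\<^sup>2 + (t - \<alpha> \<bullet> x)\<^sup>2
      = t\<^sup>2 * s / (1 + s)\<^sup>2 + 2 * t * p / (1 + s) + (norm z)\<^sup>2 + (t / (1 + s) - p)\<^sup>2"
    by (simp only: ax xx)
  \<comment> \<open>The mixed term 2 t p / (1 + s) cancels against the one from the last square; the
    coefficients s / (1 + s)^2 and 1 / (1 + s)^2 of t^2 add up.\<close>
  also have "\<dots> = t\<^sup>2 * ((1 + s) / (1 + s)\<^sup>2) + (norm z)\<^sup>2 + p\<^sup>2"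
    by (simp add: power2_diff power_divide add_divide_distrib distrib_left)
  also have "(1 + s) / (1 + s)\<^sup>2 = 1 / (1 + s)"
    using s by (simp add: power2_eq_square)
  finally have "(norm x)\<^sup>2 + (t - \<alpha> \<bullet> x)\<^sup>2 = t\<^sup>2 * (1 / (1 + s)) + (norm z)\<^sup>2 + p\<^sup>2" .
  moreover have "- t\<^sup>2 / (2 * (1 + s)) = - (t\<^sup>2 * (1 / (1 + s))) / 2"
    using s by (simp add: field_simps)
  \<comment> \<open>Stating the division by -2 abstractly keeps the large terms atomic;
    \<open>F\<close> is the exponent in the form used by \<open>normal_density\<close>.\<close>
  moreover have "- A / 2 + - B / 2 = F + (- D / 2 + - E / 2)"
    if "A + B = C + D + E" "F = - C / 2" for A B C D E F :: real
    using that by simp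
  ultimately have expo: "- (norm x)\<^sup>2 / 2 + - (t - \<alpha> \<bullet> x)\<^sup>2 / 2
      = - t\<^sup>2 / (2 * (1 + s)) + (- (norm z)\<^sup>2 / 2 + - p\<^sup>2 / 2)"
    by blast
  define C where "C = (2 * pi) powr (- (real CARD('n) / 2))"
  have "std_normal_vec_density x * std_normal_density (t - \<alpha> \<bullet> x)
      = C * (1 / sqrt (2 * pi)) * exp (- (norm x)\<^sup>2 / 2 + - (t - \<alpha> \<bullet> x)\<^sup>2 / 2)"
    unfolding exp_add by (simp add: std_normal_vec_density_def std_normal_density_def C_def)
  also have "\<dots> = C * (1 / sqrt (2 * pi)) * (exp (- t\<^sup>2 / (2 * (1 + s))) * (exp (- (norm z)\<^sup>2 / 2) * exp (- p\<^sup>2 / 2)))"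
    unfolding expo exp_add ..
  \<comment> \<open>Inserting \<open>sqrt (1 + s)\<close> in a denominator and a numerator
    normalizes the factor in t and leaves the compensating root in the factor in z.\<close>
  also have "\<dots> = (1 / sqrt (2 * pi * (1 + s)) * exp (- t\<^sup>2 / (2 * (1 + s))))
      * (sqrt (1 + s) * (C * exp (- (norm z)\<^sup>2 / 2)) * exp (- p\<^sup>2 / 2))"
    using s by (simp add: real_sqrt_mult)
  also have "\<dots> = normal_density 0 (skew_scale \<alpha>) t * residual_density \<alpha> z"
    using s by (simp add: normal_density_def residual_density_def std_normal_vec_density_def C_def s_def p_def)
  finally show ?thesis .
qed

section \<open>Change of variables for the two laws\<close>

text \<open>Tonelli moves the integral over t outside; for fixed t, x = t \<beta> + z is a
  translation, so the factorization applies without a Jacobian. The weight \<open>u\<close> serves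
  both laws: 1 gives the standard normal one, twice the indicator of \<open>{0..}\<close> the skew
  normal one.\<close>

lemma nn_integral_skew_change_of_variables:
  fixes \<alpha> :: "real ^ 'n" and H :: "real ^ 'n \<Rightarrow> ennreal" and u :: "real \<Rightarrow> ennreal"
  assumes [measurable]: "H \<in> borel_measurable borel" "u \<in> borel_measurable borel"
  shows "(\<integral>\<^sup>+x. H x * (ennreal (std_normal_vec_density x)
            * (\<integral>\<^sup>+t. u t * ennreal (std_normal_density (t - \<alpha> \<bullet> x)) \<partial>lborel)) \<partial>lborel)
       = (\<integral>\<^sup>+t. u t * (ennreal (normal_density 0 (skew_scale \<alpha>) t)
            * (\<integral>\<^sup>+z. ennreal (residual_density \<alpha> z) * H (t *\<^sub>R skew_direction \<alpha> + z) \<partial>lborel)) \<partial>lborel)"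
    (is "?L = ?R")
proof -
  have "?L = (\<integral>\<^sup>+x. (\<integral>\<^sup>+t. H x * (ennreal (std_normal_vec_density x)
            * (u t * ennreal (std_normal_density (t - \<alpha> \<bullet> x)))) \<partial>lborel) \<partial>lborel)"
    by (simp add: nn_integral_cmult)
  also have "\<dots> = (\<integral>\<^sup>+t. (\<integral>\<^sup>+x. H x * (ennreal (std_normal_vec_density x)
            * (u t * ennreal (std_normal_density (t - \<alpha> \<bullet> x)))) \<partial>lborel) \<partial>lborel)"
    by (rule lborel_pair.Fubini') measurable
  also have "\<dots> = (\<integral>\<^sup>+t. (\<integral>\<^sup>+x. u t * (H x
            * ennreal (std_normal_vec_density x * std_normal_density (t - \<alpha> \<bullet> x))) \<partial>lborel) \<partial>lborel)"
    by (simp add: ennreal_mult mult_ac)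
  also have "\<dots> = (\<integral>\<^sup>+t. (\<integral>\<^sup>+z. u t * (H (t *\<^sub>R skew_direction \<alpha> + z)
            * ennreal (normal_density 0 (skew_scale \<alpha>) t * residual_density \<alpha> z)) \<partial>lborel) \<partial>lborel)"
  proof (rule nn_integral_cong)
    fix t
    show "(\<integral>\<^sup>+x. u t * (H x * ennreal (std_normal_vec_density x * std_normal_density (t - \<alpha> \<bullet> x))) \<partial>lborel)
        = (\<integral>\<^sup>+z. u t * (H (t *\<^sub>R skew_direction \<alpha> + z)
            * ennreal (normal_density 0 (skew_scale \<alpha>) t * residual_density \<alpha> z)) \<partial>lborel)"
      by (subst nn_integral_lborel_translate[where c = "t *\<^sub>R skew_direction \<alpha>"])
         (simp_all only: skew_density_factorization, measurable)
  qed
  also have "\<dots> = (\<integral>\<^sup>+t. (\<integral>\<^sup>+z. (u t * ennreal (normal_density 0 (skew_scale \<alpha>) t)) *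
            (ennreal (residual_density \<alpha> z) * H (t *\<^sub>R skew_direction \<alpha> + z)) \<partial>lborel) \<partial>lborel)"
    by (simp add: ennreal_mult mult_ac)
  also have "\<dots> = ?R"
    by (simp add: nn_integral_cmult mult.assoc)
  finally show ?thesis .
qed

lemma nn_integral_normal_density:
  "0 < \<sigma> \<Longrightarrow> (\<integral>\<^sup>+t. ennreal (normal_density \<mu> \<sigma> t) \<partial>lborel) = 1"
  by (simp add: nn_integral_eq_integral)

lemma nn_integral_std_normal_density_shift:
  "(\<integral>\<^sup>+t. ennreal (std_normal_density (t - a)) \<partial>lborel) = 1"
proof -
  have "std_normal_density (t - a) = normal_density a 1 t" for t
    by (simp add: normal_density_def)
  then show ?thesis by (simp add: nn_integral_normal_density)
qed

lemma nn_integral_std_normal_vec_change_of_variables: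
  fixes \<alpha> :: "real ^ 'n" and H :: "real ^ 'n \<Rightarrow> ennreal"
  assumes [measurable]: "H \<in> borel_measurable borel"
  shows "(\<integral>\<^sup>+x. H x * ennreal (std_normal_vec_density x) \<partial>lborel)
       = (\<integral>\<^sup>+t. ennreal (normal_density 0 (skew_scale \<alpha>) t)
            * (\<integral>\<^sup>+z. ennreal (residual_density \<alpha> z) * H (t *\<^sub>R skew_direction \<alpha> + z) \<partial>lborel) \<partial>lborel)"
  using nn_integral_skew_change_of_variables[of H "\<lambda>_. 1" \<alpha>]
  by (simp add: nn_integral_std_normal_density_shift)

text \<open>The change of variables leaves an integral over t \<ge> 0 with weight 2. As the density
  of T is even, \<open>nn_integral_abs_eq\<close> spreads it over the whole line.\<close>

lemma nn_integral_skew_normal_change_of_variables: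
  fixes \<alpha> :: "real ^ 'n" and H :: "real ^ 'n \<Rightarrow> ennreal"
  assumes [measurable]: "H \<in> borel_measurable borel"
  shows "(\<integral>\<^sup>+x. H x * ennreal (skew_normal_density \<alpha> x) \<partial>lborel)
       = (\<integral>\<^sup>+t. ennreal (normal_density 0 (skew_scale \<alpha>) t)
            * (\<integral>\<^sup>+z. ennreal (residual_density \<alpha> z) * H (\<bar>t\<bar> *\<^sub>R skew_direction \<alpha> + z) \<partial>lborel) \<partial>lborel)"
proof -
  have eq: "ennreal (skew_normal_density \<alpha> x) = ennreal (std_normal_vec_density x)
            * (\<integral>\<^sup>+t. 2 * indicator {0..} t * ennreal (std_normal_density (t - \<alpha> \<bullet> x)) \<partial>lborel)" for x
    by (simp add: skew_normal_density_def ennreal_mult std_normal_cdf_eq_nn_integral nn_integral_cmult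
        mult.assoc mult.left_commute)
  have even: "normal_density 0 (skew_scale \<alpha>) \<bar>t\<bar> = normal_density 0 (skew_scale \<alpha>) t" for t
    by (simp add: normal_density_def)
  show ?thesis
    unfolding eq
    using nn_integral_abs_eq[of "\<lambda>t. ennreal (normal_density 0 (skew_scale \<alpha>) t)
            * (\<integral>\<^sup>+z. ennreal (residual_density \<alpha> z) * H (t *\<^sub>R skew_direction \<alpha> + z) \<partial>lborel)"]
    by (subst nn_integral_skew_change_of_variables) (simp_all add: even)
qed

text \<open>The total mass is read off from the change of variables with test function 1, since Z
  and T have densities of mass 1. This avoids computing a covariance determinant.\<close>

lemma prob_space_residual: "prob_space (density lborel (\<lambda>z. ennreal (residual_density \<alpha> z)))"
proof (rule prob_spaceI)
  have "1 = (\<integral>\<^sup>+t. ennreal (normal_density 0 (skew_scale \<alpha>) t)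
            * (\<integral>\<^sup>+z. ennreal (residual_density \<alpha> z) \<partial>lborel) \<partial>lborel)"
    using nn_integral_std_normal_vec_change_of_variables[of "\<lambda>_. 1" \<alpha>]
    by (simp add: nn_integral_std_normal_vec_density)
  also have "\<dots> = (\<integral>\<^sup>+z. ennreal (residual_density \<alpha> z) \<partial>lborel)"
    by (simp add: nn_integral_multc nn_integral_normal_density one_plus_norm_sq_pos)
  finally show "emeasure (density lborel (\<lambda>z. ennreal (residual_density \<alpha> z)))
      (space (density lborel (\<lambda>z. ennreal (residual_density \<alpha> z)))) = 1"
    by (simp add: emeasure_density)
qed

lemma integrable_norm_residual:
  fixes \<alpha> :: "real ^ 'n"
  shows "integrable (density lborel (\<lambda>z. ennreal (residual_density \<alpha> z))) norm"
proof -
  have "integrable lborel (\<lambda>z. residual_density \<alpha> z * norm z)"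
  proof (rule Bochner_Integration.integrable_bound)
    show "integrable lborel (\<lambda>z :: real ^ 'n. skew_scale \<alpha> * (std_normal_vec_density z * norm z))"
      by (intro integrable_mult_right integrable_norm_std_normal_vec_density)
    have "residual_density \<alpha> z * norm z \<le> skew_scale \<alpha> * (std_normal_vec_density z * norm z)" for z
    proof -
      have "exp (- (\<alpha> \<bullet> z)\<^sup>2 / 2) \<le> 1" by simp
      then have "(skew_scale \<alpha> * std_normal_vec_density z * norm z) * exp (- (\<alpha> \<bullet> z)\<^sup>2 / 2)
          \<le> skew_scale \<alpha> * std_normal_vec_density z * norm z"
        by (intro mult_left_le) auto
      then show ?thesis by (simp add: residual_density_def mult_ac)
    qed
    then show "AE z in lborel. norm (residual_density \<alpha> z * norm z)
        \<le> norm (skew_scale \<alpha> * (std_normal_vec_density z * norm z))"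
      by simp
  qed measurable
  then show ?thesis
    by (simp add: integrable_real_density)
qed

section \<open>The coupling of the two laws\<close>

text \<open>The coordinates are the independent T and W. Both laws are images of this one measure,
  under maps that differ only where t < 0.\<close>

definition coupling_space :: "real ^ 'n \<Rightarrow> (real \<times> (real ^ 'n)) measure" where
  "coupling_space \<alpha> = density lborel (\<lambda>t. ennreal (normal_density 0 (skew_scale \<alpha>) t))
     \<Otimes>\<^sub>M density lborel (\<lambda>z. ennreal (residual_density \<alpha> z))"

lemma sets_coupling_space [measurable_cong]: "sets (coupling_space \<alpha>) = sets (borel \<Otimes>\<^sub>M borel)"
  unfolding coupling_space_def by (intro sets_pair_measure_cong) simp_all

lemma prob_space_coupling_space: "prob_space (coupling_space \<alpha>)"
  unfolding coupling_space_def
  by (intro prob_space_pair prob_space_normal_density prob_space_residual skew_scale_pos)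

lemma nn_integral_coupling_space:
  fixes \<alpha> :: "real ^ 'n"
  assumes [measurable]: "f \<in> borel_measurable (borel \<Otimes>\<^sub>M borel)"
  shows "(\<integral>\<^sup>+w. f w \<partial>coupling_space \<alpha>) = (\<integral>\<^sup>+t. ennreal (normal_density 0 (skew_scale \<alpha>) t)
            * (\<integral>\<^sup>+z. ennreal (residual_density \<alpha> z) * f (t, z) \<partial>lborel) \<partial>lborel)"
proof -
  interpret R: prob_space "density lborel (\<lambda>z. ennreal (residual_density \<alpha> z))"
    by (rule prob_space_residual)
  have "(\<integral>\<^sup>+w. f w \<partial>coupling_space \<alpha>)
      = (\<integral>\<^sup>+t. (\<integral>\<^sup>+z. f (t, z) \<partial>density lborel (\<lambda>z. ennreal (residual_density \<alpha> z)))
           \<partial>density lborel (\<lambda>t. ennreal (normal_density 0 (skew_scale \<alpha>) t)))"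
    unfolding coupling_space_def by (rule R.nn_integral_fst[symmetric]) measurable
  then show ?thesis
    by (simp add: nn_integral_density)
qed

text \<open>The change of variables, tested on the indicator of each Borel set, identifies the two
  measures.\<close>

lemma std_normal_vec_eq_distr_coupling:
  fixes \<alpha> :: "real ^ 'n"
  shows "density lborel (\<lambda>x. ennreal (std_normal_vec_density x))
   = distr (coupling_space \<alpha>) lborel (\<lambda>(t, z). t *\<^sub>R skew_direction \<alpha> + z)"
proof (rule measure_eqI)
  fix A :: "(real ^ 'n) set" assume "A \<in> sets (density lborel (\<lambda>x. ennreal (std_normal_vec_density x)))"
  then have [measurable]: "A \<in> sets borel" by simp
  have "emeasure (distr (coupling_space \<alpha>) lborel (\<lambda>(t, z). t *\<^sub>R skew_direction \<alpha> + z)) A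
      = (\<integral>\<^sup>+x. indicator A x \<partial>distr (coupling_space \<alpha>) lborel (\<lambda>(t, z). t *\<^sub>R skew_direction \<alpha> + z))"
    by simp
  also have "\<dots> = (\<integral>\<^sup>+w. indicator A (case w of (t, z) \<Rightarrow> t *\<^sub>R skew_direction \<alpha> + z) \<partial>coupling_space \<alpha>)"
    by (rule nn_integral_distr) measurable
  also have "\<dots> = emeasure (density lborel (\<lambda>x. ennreal (std_normal_vec_density x))) A"
    by (subst nn_integral_coupling_space)
       (simp_all add: emeasure_density nn_integral_std_normal_vec_change_of_variables[of "indicator A" \<alpha>]
         mult.commute[of _ "indicator A _"])
  finally show "emeasure (density lborel (\<lambda>x. ennreal (std_normal_vec_density x))) A
      = emeasure (distr (coupling_space \<alpha>) lborel (\<lambda>(t, z). t *\<^sub>R skew_direction \<alpha> + z)) A" ..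
qed simp

lemma borel_measurable_skew_normal_density [measurable]:
  "skew_normal_density \<alpha> \<in> borel_measurable borel"
proof -
  interpret real_distribution std_normal_distribution by (rule real_dist_normal_dist)
  have [measurable]: "std_normal_cdf \<in> borel_measurable borel"
    unfolding std_normal_cdf_def by (intro borel_measurable_mono monoI cdf_nondecreasing)
  show ?thesis unfolding skew_normal_density_def by measurable
qed

lemma skew_normal_eq_distr_coupling:
  fixes \<alpha> :: "real ^ 'n"
  shows "density lborel (\<lambda>x. ennreal (skew_normal_density \<alpha> x))
   = distr (coupling_space \<alpha>) lborel (\<lambda>(t, z). \<bar>t\<bar> *\<^sub>R skew_direction \<alpha> + z)"
proof (rule measure_eqI)
  fix A :: "(real ^ 'n) set" assume "A \<in> sets (density lborel (\<lambda>x. ennreal (skew_normal_density \<alpha> x)))"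
  then have [measurable]: "A \<in> sets borel" by simp
  have "emeasure (distr (coupling_space \<alpha>) lborel (\<lambda>(t, z). \<bar>t\<bar> *\<^sub>R skew_direction \<alpha> + z)) A
      = (\<integral>\<^sup>+x. indicator A x \<partial>distr (coupling_space \<alpha>) lborel (\<lambda>(t, z). \<bar>t\<bar> *\<^sub>R skew_direction \<alpha> + z))"
    by simp
  also have "\<dots> = (\<integral>\<^sup>+w. indicator A (case w of (t, z) \<Rightarrow> \<bar>t\<bar> *\<^sub>R skew_direction \<alpha> + z) \<partial>coupling_space \<alpha>)"
    by (rule nn_integral_distr) measurable
  also have "\<dots> = emeasure (density lborel (\<lambda>x. ennreal (skew_normal_density \<alpha> x))) A"
    by (subst nn_integral_coupling_space)
       (simp_all add: emeasure_density nn_integral_skew_normal_change_of_variables[of "indicator A" \<alpha>]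
         mult.commute[of _ "indicator A _"])
  finally show "emeasure (density lborel (\<lambda>x. ennreal (skew_normal_density \<alpha> x))) A
      = emeasure (distr (coupling_space \<alpha>) lborel (\<lambda>(t, z). \<bar>t\<bar> *\<^sub>R skew_direction \<alpha> + z)) A" ..
qed simp

section \<open>First moments on the coupling space\<close>

text \<open>The second factor has mass 1, so the first projection has the law of T and its moments
  are one-dimensional normal moments.\<close>

lemma integral_coupling_space_fst:
  fixes f :: "real \<Rightarrow> real"
  assumes [measurable]: "f \<in> borel_measurable borel"
  shows "(\<integral>w. f (fst w) \<partial>coupling_space \<alpha>) = (\<integral>t. normal_density 0 (skew_scale \<alpha>) t * f t \<partial>lborel)"
    and "integrable (coupling_space \<alpha>) (\<lambda>w. f (fst w))
      \<longleftrightarrow> integrable lborel (\<lambda>t. normal_density 0 (skew_scale \<alpha>) t * f t)"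
proof -
  let ?T = "density lborel (\<lambda>t. ennreal (normal_density 0 (skew_scale \<alpha>) t))"
  interpret R: prob_space "density lborel (\<lambda>z. ennreal (residual_density \<alpha> z))"
    by (rule prob_space_residual)
  have *: "distr (coupling_space \<alpha>) ?T fst = ?T"
    unfolding coupling_space_def by (rule R.distr_pair_fst)
  have [measurable]: "fst \<in> measurable (coupling_space \<alpha>) ?T"
    by measurable
  show "(\<integral>w. f (fst w) \<partial>coupling_space \<alpha>) = (\<integral>t. normal_density 0 (skew_scale \<alpha>) t * f t \<partial>lborel)"
    using integral_distr[of fst "coupling_space \<alpha>" ?T f] unfolding *
    by (simp add: integral_real_density)
  show "integrable (coupling_space \<alpha>) (\<lambda>w. f (fst w))
      \<longleftrightarrow> integrable lborel (\<lambda>t. normal_density 0 (skew_scale \<alpha>) t * f t)"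
    using integrable_distr_eq[of fst "coupling_space \<alpha>" ?T f] unfolding *
    by (simp add: integrable_real_density)
qed

lemma integrable_coupling_space_fst: "integrable (coupling_space \<alpha>) fst"
  and integral_coupling_space_fst_eq_0: "(\<integral>w. fst w \<partial>coupling_space \<alpha>) = 0"
  and integrable_coupling_space_abs_fst: "integrable (coupling_space \<alpha>) (\<lambda>w. \<bar>fst w\<bar>)"
  and integral_coupling_space_abs_fst:
    "(\<integral>w. \<bar>fst w\<bar> \<partial>coupling_space \<alpha>) = skew_scale \<alpha> * sqrt (2 / pi)"
  \<comment> \<open>The mean 0 is the first moment; the odd absolute moment with index 0 is the mean
    of the absolute value.\<close>
  using integral_coupling_space_fst[of "\<lambda>t. t" \<alpha>] integral_coupling_space_fst[of abs \<alpha>]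
    normal_moment_nz_1[OF skew_scale_pos[of \<alpha>], of 0] normal_moment_abs_odd[OF skew_scale_pos[of \<alpha>], of 0 0]
  by (simp_all add: has_bochner_integral_iff)

lemma integrable_coupling_space_norm_snd: "integrable (coupling_space \<alpha>) (\<lambda>w. norm (snd w))"
proof (rule integrableI_bounded)
  show "(\<lambda>w. norm (snd w)) \<in> borel_measurable (coupling_space \<alpha>)"
    by measurable
  have "(\<integral>\<^sup>+z. ennreal (residual_density \<alpha> z) * ennreal (norm z) \<partial>lborel) < \<infinity>"
    using integrable_norm_residual[of \<alpha>] by (simp add: integrable_iff_bounded nn_integral_density)
  then show "(\<integral>\<^sup>+w. ennreal (norm (norm (snd w))) \<partial>coupling_space \<alpha>) < \<infinity>"
    by (simp add: nn_integral_coupling_space nn_integral_multc nn_integral_normal_density one_plus_norm_sq_pos)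
qed

section \<open>Lipschitz functions of the coupled vectors\<close>

lemma lipschitz_bounded_linear_growth:
  fixes h :: "'a::real_normed_vector \<Rightarrow> real"
  assumes "1-lipschitz_on UNIV h"
  shows "\<bar>h x\<bar> \<le> \<bar>h 0\<bar> + norm x"
  using lipschitz_onD[OF assms, of x 0] by (simp add: dist_norm)

lemma borel_measurable_lipschitz:
  fixes h :: "'a::metric_space \<Rightarrow> 'b::metric_space"
  assumes "L-lipschitz_on UNIV h"
  shows "h \<in> borel_measurable borel"
  by (intro borel_measurable_continuous_onI lipschitz_on_continuous_on[OF assms])

text \<open>The function \<open>g\<close> covers both vectors at once: the identity for Z and
  \<open>abs\<close> for X. Linear growth of \<open>h\<close> reduces the claim to first moments of
  T and W.\<close>

lemma integrable_coupling_space_lipschitz: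
  fixes h :: "real ^ 'n \<Rightarrow> real" and g :: "real \<Rightarrow> real"
  assumes h: "1-lipschitz_on UNIV h" and [measurable]: "g \<in> borel_measurable borel"
    and g: "\<And>t. \<bar>g t\<bar> = \<bar>t\<bar>"
  shows "integrable (coupling_space \<alpha>) (\<lambda>(t, z). h (g t *\<^sub>R skew_direction \<alpha> + z))"
proof (rule Bochner_Integration.integrable_bound)
  interpret prob_space "coupling_space \<alpha>" by (rule prob_space_coupling_space)
  have [measurable]: "h \<in> borel_measurable borel" by (rule borel_measurable_lipschitz[OF h])
  show "integrable (coupling_space \<alpha>)
      (\<lambda>w. \<bar>h 0\<bar> + (\<bar>fst w\<bar> * norm (skew_direction \<alpha>) + norm (snd w)))"
    by (intro Bochner_Integration.integrable_add integrable_const integrable_mult_left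
        integrable_coupling_space_abs_fst integrable_coupling_space_norm_snd)
  show "(\<lambda>(t, z). h (g t *\<^sub>R skew_direction \<alpha> + z)) \<in> borel_measurable (coupling_space \<alpha>)"
    by measurable
  have "\<bar>h (g t *\<^sub>R skew_direction \<alpha> + z)\<bar> \<le> \<bar>h 0\<bar> + (\<bar>t\<bar> * norm (skew_direction \<alpha>) + norm z)" for t z
    using lipschitz_bounded_linear_growth[OF h, of "g t *\<^sub>R skew_direction \<alpha> + z"]
      norm_triangle_ineq[of "g t *\<^sub>R skew_direction \<alpha>" z] by (simp add: g)
  then show "AE w in coupling_space \<alpha>. norm (case w of (t, z) \<Rightarrow> h (g t *\<^sub>R skew_direction \<alpha> + z))
      \<le> norm (\<bar>h 0\<bar> + (\<bar>fst w\<bar> * norm (skew_direction \<alpha>) + norm (snd w)))"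
    by (auto simp: abs_of_nonneg intro!: AE_I2)
qed

section \<open>Evaluation of the distance through the coupling\<close>

theorem proposition4p11:
  fixes \<alpha> :: "real ^ 'n"
    and M :: "'a measure" and X :: "'a \<Rightarrow> real ^ 'n"
    and N :: "'b measure" and Z :: "'b \<Rightarrow> real ^ 'n"
  assumes "prob_space M"
    and "prob_space N"
    and "distributed M lborel X (\<lambda>x. ennreal (skew_normal_density \<alpha> x))"
    and "distributed N lborel Z (\<lambda>x. ennreal (std_normal_vec_density x))"
  shows "wasserstein1 M X N Z =
           ereal (sqrt (2 / pi) * (norm \<alpha> / sqrt (1 + (norm \<alpha>)\<^sup>2)))"
proof -
  let ?P = "coupling_space \<alpha>"
  let ?\<beta> = "skew_direction \<alpha>"
  let ?w = "sqrt (2 / pi) * (norm \<alpha> / sqrt (1 + (norm \<alpha>)\<^sup>2))"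
  have [measurable]: "X \<in> measurable M lborel" "Z \<in> measurable N lborel"
    using assms(3,4) by (simp_all add: distributed_def)
  have EX: "(\<integral>\<omega>. h (X \<omega>) \<partial>M) = (\<integral>(t, z). h (\<bar>t\<bar> *\<^sub>R ?\<beta> + z) \<partial>?P)"
    if [measurable]: "h \<in> borel_measurable borel" for h :: "real ^ 'n \<Rightarrow> real"
  proof -
    have "(\<integral>\<omega>. h (X \<omega>) \<partial>M) = (\<integral>x. h x \<partial>distr M lborel X)"
      by (rule integral_distr[symmetric]) measurable
    also have "\<dots> = (\<integral>x. h x \<partial>distr ?P lborel (\<lambda>(t, z). \<bar>t\<bar> *\<^sub>R ?\<beta> + z))"
      by (simp only: distributed_distr_eq_density[OF assms(3)] skew_normal_eq_distr_coupling)
    also have "\<dots> = (\<integral>(t, z). h (\<bar>t\<bar> *\<^sub>R ?\<beta> + z) \<partial>?P)"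
      by (subst integral_distr) (auto simp: split_beta')
    finally show ?thesis .
  qed
  have EZ: "(\<integral>\<omega>. h (Z \<omega>) \<partial>N) = (\<integral>(t, z). h (t *\<^sub>R ?\<beta> + z) \<partial>?P)"
    if [measurable]: "h \<in> borel_measurable borel" for h :: "real ^ 'n \<Rightarrow> real"
  proof -
    have "(\<integral>\<omega>. h (Z \<omega>) \<partial>N) = (\<integral>x. h x \<partial>distr N lborel Z)"
      by (rule integral_distr[symmetric]) measurable
    also have "\<dots> = (\<integral>x. h x \<partial>distr ?P lborel (\<lambda>(t, z). t *\<^sub>R ?\<beta> + z))"
      by (simp only: distributed_distr_eq_density[OF assms(4)] std_normal_vec_eq_distr_coupling[of \<alpha>])
    also have "\<dots> = (\<integral>(t, z). h (t *\<^sub>R ?\<beta> + z) \<partial>?P)"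
      by (subst integral_distr) (auto simp: split_beta')
    finally show ?thesis .
  qed
  \<comment> \<open>Integrability of both terms lets the difference of expectations be taken inside
    one integral, where the two vectors are compared pointwise.\<close>
  have diff: "(\<integral>\<omega>. h (X \<omega>) \<partial>M) - (\<integral>\<omega>. h (Z \<omega>) \<partial>N)
      = (\<integral>(t, z). h (\<bar>t\<bar> *\<^sub>R ?\<beta> + z) - h (t *\<^sub>R ?\<beta> + z) \<partial>?P)"
    and int: "integrable ?P (\<lambda>(t, z). h (\<bar>t\<bar> *\<^sub>R ?\<beta> + z) - h (t *\<^sub>R ?\<beta> + z))"
    if h: "1-lipschitz_on UNIV h" for h :: "real ^ 'n \<Rightarrow> real"
  proof -
    have i: "integrable ?P (\<lambda>(t, z). h (\<bar>t\<bar> *\<^sub>R ?\<beta> + z))" "integrable ?P (\<lambda>(t, z). h (t *\<^sub>R ?\<beta> + z))"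
      using integrable_coupling_space_lipschitz[OF h, of abs \<alpha>]
        integrable_coupling_space_lipschitz[OF h, of "\<lambda>t. t" \<alpha>] by simp_all
    show "(\<integral>\<omega>. h (X \<omega>) \<partial>M) - (\<integral>\<omega>. h (Z \<omega>) \<partial>N)
        = (\<integral>(t, z). h (\<bar>t\<bar> *\<^sub>R ?\<beta> + z) - h (t *\<^sub>R ?\<beta> + z) \<partial>?P)"
      unfolding EX[OF borel_measurable_lipschitz[OF h]] EZ[OF borel_measurable_lipschitz[OF h]]
      using Bochner_Integration.integral_diff[OF i] by (simp add: split_beta')
    show "integrable ?P (\<lambda>(t, z). h (\<bar>t\<bar> *\<^sub>R ?\<beta> + z) - h (t *\<^sub>R ?\<beta> + z))"
      using Bochner_Integration.integrable_diff[OF i] by (simp add: split_beta')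
  qed
  have cost_int: "integrable ?P (\<lambda>w. (\<bar>fst w\<bar> - fst w) * norm ?\<beta>)"
    by (intro integrable_mult_left Bochner_Integration.integrable_diff
        integrable_coupling_space_abs_fst integrable_coupling_space_fst)
  have cost: "(\<integral>w. (\<bar>fst w\<bar> - fst w) * norm ?\<beta> \<partial>?P) = ?w"
  proof -
    \<comment> \<open>T has mean 0, so only the mean of its absolute value survives.\<close>
    have "(\<integral>w. (\<bar>fst w\<bar> - fst w) * norm ?\<beta> \<partial>?P) = skew_scale \<alpha> * sqrt (2 / pi) * norm ?\<beta>"
      by (simp add: integrable_coupling_space_abs_fst integrable_coupling_space_fst
          integral_coupling_space_abs_fst integral_coupling_space_fst_eq_0)
    \<comment> \<open>The denominator of the norm of \<beta> is the square of the scale of T, so one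
      factor cancels.\<close>
    also have "1 + (norm \<alpha>)\<^sup>2 = skew_scale \<alpha> * skew_scale \<alpha>"
      using one_plus_norm_sq_pos[of \<alpha>] by simp
    then have "skew_scale \<alpha> * sqrt (2 / pi) * norm ?\<beta> = ?w"
      using skew_scale_pos[of \<alpha>] unfolding norm_skew_direction by (simp add: field_simps)
    finally show ?thesis .
  qed
  show ?thesis
    unfolding wasserstein1_def
  proof (rule SUP_eqI)
    fix h :: "real ^ 'n \<Rightarrow> real" assume "h \<in> {h. 1-lipschitz_on UNIV h}"
    then have h: "1-lipschitz_on UNIV h" by simp
    have "\<bar>(\<integral>\<omega>. h (X \<omega>) \<partial>M) - (\<integral>\<omega>. h (Z \<omega>) \<partial>N)\<bar>
        \<le> (\<integral>w. norm (case w of (t, z) \<Rightarrow> h (\<bar>t\<bar> *\<^sub>R ?\<beta> + z) - h (t *\<^sub>R ?\<beta> + z)) \<partial>?P)"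
      unfolding diff[OF h] real_norm_def[symmetric] by (rule integral_norm_bound)
    also have "\<dots> \<le> (\<integral>w. (\<bar>fst w\<bar> - fst w) * norm ?\<beta> \<partial>?P)"
    proof (rule integral_mono[OF integrable_norm[OF int[OF h]] cost_int])
      fix w :: "real \<times> (real ^ 'n)"
      obtain t z where w: "w = (t, z)" by fastforce
      have "\<bar>h (\<bar>t\<bar> *\<^sub>R ?\<beta> + z) - h (t *\<^sub>R ?\<beta> + z)\<bar> \<le> norm ((\<bar>t\<bar> *\<^sub>R ?\<beta> + z) - (t *\<^sub>R ?\<beta> + z))"
        using lipschitz_onD[OF h, of "\<bar>t\<bar> *\<^sub>R ?\<beta> + z" "t *\<^sub>R ?\<beta> + z"] by (simp add: dist_norm)
      also have "(\<bar>t\<bar> *\<^sub>R ?\<beta> + z) - (t *\<^sub>R ?\<beta> + z) = (\<bar>t\<bar> - t) *\<^sub>R ?\<beta>"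
        by (simp add: algebra_simps)
      finally show "norm (case w of (t, z) \<Rightarrow> h (\<bar>t\<bar> *\<^sub>R ?\<beta> + z) - h (t *\<^sub>R ?\<beta> + z))
          \<le> (\<bar>fst w\<bar> - fst w) * norm ?\<beta>"
        by (simp add: w)
    qed
    finally show "ereal \<bar>(\<integral>\<omega>. h (X \<omega>) \<partial>M) - (\<integral>\<omega>. h (Z \<omega>) \<partial>N)\<bar> \<le> ereal ?w"
      unfolding cost by simp
  next
    fix y :: ereal
    assume y: "\<And>h. h \<in> {h :: real ^ 'n \<Rightarrow> real. 1-lipschitz_on UNIV h} \<Longrightarrow>
      ereal \<bar>(\<integral>\<omega>. h (X \<omega>) \<partial>M) - (\<integral>\<omega>. h (Z \<omega>) \<partial>N)\<bar> \<le> y"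
    \<comment> \<open>Projection onto the unit vector along \<beta> sees the full displacement
      (\<bar>t\<bar> - t) \<beta>. If \<beta> = 0, \<open>sgn\<close> returns 0 and \<open>h\<close>
      vanishes, in agreement with a distance of 0.\<close>
    define h :: "real ^ 'n \<Rightarrow> real" where "h x = x \<bullet> sgn ?\<beta>" for x
    have h: "1-lipschitz_on UNIV h"
    proof (rule lipschitz_onI)
      fix x y :: "real ^ 'n"
      have "\<bar>(x - y) \<bullet> sgn ?\<beta>\<bar> \<le> norm (x - y) * norm (sgn ?\<beta>)" by (rule Cauchy_Schwarz_ineq2)
      \<comment> \<open>The norm of \<open>sgn\<close> is 1, or 0 when \<beta> = 0; hence only an
        inequality.\<close>
      also have "\<dots> \<le> norm (x - y)" by (intro mult_left_le) (simp_all add: norm_sgn)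
      finally show "dist (h x) (h y) \<le> 1 * dist x y"
        by (simp add: h_def dist_norm inner_diff_left)
    qed simp
    have "?\<beta> \<bullet> sgn ?\<beta> = norm ?\<beta>"
      by (cases "?\<beta> = 0") (simp_all add: sgn_div_norm flip: power2_norm_eq_inner, simp add: power2_eq_square)
    then have "(\<integral>\<omega>. h (X \<omega>) \<partial>M) - (\<integral>\<omega>. h (Z \<omega>) \<partial>N) = (\<integral>w. (\<bar>fst w\<bar> - fst w) * norm ?\<beta> \<partial>?P)"
      unfolding diff[OF h] by (simp add: h_def inner_add_left split_beta' algebra_simps)
    then show "ereal ?w \<le> y"
      using y[of h] h unfolding cost by (simp add: abs_of_nonneg)
  qed
qed

end
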